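(* Let $T>0$, $X\in C^2([0,T]^2;\mathbb{R}^d)$, and let $\mathbf{S}^{\mathrm{id}}(X)$ be its $\mathrm{id}$-signature. Let $n\ge1$ and let $w=(w_1,\dots,w_n)$ be a word in $\{1,\dots,d\}$. Let $\mathbf s=(s_1,s_2),\mathbf t=(t_1,t_2)\in[0,T]^2$ with $s_1\le t_1$, $s_2\le t_2$. Then: (i) for every $u_1\in[s_1,t_1]$, $$\langle\delta^1_{u_1}\mathbf S^{\mathrm{id}}_{\mathbf s\mathbf t}(X),w\rangle=\sum_{k=1}^{n-1}\langle\mathbf S^{\mathrm{id}}_{(u_1,s_2),\mathbf t}(X),(w_{k+1},\dots,w_n)\rangle\ast_1\langle\mathbf S^{\mathrm{id}}_{\mathbf s,(u_1,\cdot)}(X),(w_1,\dots,w_k)\rangle;$$ (ii) for every $u_2\in[s_2,t_2]$, $$\langle\delta^2_{u_2}\mathbf S^{\mathrm{id}}_{\mathbf s\mathbf t}(X),w\rangle=\sum_{k=1}^{n-1}\langle\mathbf S^{\mathrm{id}}_{(s_1,u_2),\mathbf t}(X),(w_{k+1},\dots,w_n)\rangle\ast_2\langle\mathbf S^{\mathrm{id}}_{\mathbf s,(\cdot,u_2)}(X),(w_1,\dots,w_k)\rangle.$$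
   Context: $\mathrm{id}$-signature: with $\partial_{12}X=\frac{\partial^2X}{\partial r_1\partial r_2}$ and $dX^i_{\mathbf r}=\partial_{12}X^i(r_1,r_2)\,dr_1dr_2$, define recursively $\langle\mathbf S^{\mathrm{id}}_{\mathbf s\mathbf t}(X),\mathsf e\rangle=1$ for the empty word $\mathsf e$ and, for $w=(i_1,\dots,i_n)$, $n\ge1$, $$\langle\mathbf S^{\mathrm{id}}_{\mathbf s\mathbf t}(X),w\rangle=\int_{[s_1,t_1]\times[s_2,t_2]}\langle\mathbf S^{\mathrm{id}}_{\mathbf s\mathbf r}(X),(i_1,\dots,i_{n-1})\rangle\,dX^{i_n}_{\mathbf r}.$$ Directional $\delta$ operators: $\delta^1_{u_1}\mathbf S^{\mathrm{id}}_{\mathbf s\mathbf t}=\mathbf S^{\mathrm{id}}_{\mathbf s\mathbf t}-\mathbf S^{\mathrm{id}}_{\mathbf s,(u_1,t_2)}-\mathbf S^{\mathrm{id}}_{(u_1,s_2),\mathbf t}$ and $\delta^2_{u_2}\mathbf S^{\mathrm{id}}_{\mathbf s\mathbf t}=\mathbf S^{\mathrm{id}}_{\mathbf s\mathbf t}-\mathbf S^{\mathrm{id}}_{\mathbf s,(t_1,u_2)}-\mathbf S^{\mathrm{id}}_{(s_1,u_2),\mathbf t}$, evaluated word by word. Let $\Delta^m_{a,b}=\{(r^1,\dots,r^m): a\le r^1\le\dots\le r^m\le b\}$. Convolution products, for nonempty words $v$ of length $m$ and $v'$ of arbitrary length $\ge 1$: Horizontal: $$\langle\mathbf S^{\mathrm{id}}_{(a,s_2),(b,t_2)}(X),v\rangle\ast_1\langle\mathbf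 S^{\mathrm{id}}_{(c,s_2),(d',\cdot)}(X),v'\rangle:=\int\langle\mathbf S^{\mathrm{id}}_{(c,s_2),(d',r_2^1)}(X),v'\rangle\prod_{j=1}^m dX^{v_j}_{(r_1^j,r_2^j)},$$ the integral being over $(r_1^1,\dots,r_1^m)\in\Delta^m_{a,b}$, $(r_2^1,\dots,r_2^m)\in\Delta^m_{s_2,t_2}$. Vertical: $$\langle\mathbf S^{\mathrm{id}}_{(s_1,a),(t_1,b)}(X),v\rangle\ast_2\langle\mathbf S^{\mathrm{id}}_{(s_1,c),(\cdot,d')}(X),v'\rangle:=\int\langle\mathbf S^{\mathrm{id}}_{(s_1,c),(r_1^1,d')}(X),v'\rangle\prod_{j=1}^m dX^{v_j}_{(r_1^j,r_2^j)},$$ the integral being over $(r_1^1,\dots,r_1^m)\in\Delta^m_{s_1,t_1}$, $(r_2^1,\dots,r_2^m)\in\Delta^m_{a,b}$. *)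

theory Defs
  imports "HOL-Analysis.Analysis"
begin

text \<open>
  Twice continuously differentiable on \<open>S\<close>: all derivatives are Frechet derivatives relative
  to \<open>S\<close>, hence one-sided at the boundary of a closed box, and nothing is required of \<open>f\<close>
  outside \<open>S\<close>.
\<close>

definition C2_on :: "'a::real_normed_vector set \<Rightarrow> ('a \<Rightarrow> 'b::real_normed_vector) \<Rightarrow> bool" where
  "C2_on S f \<longleftrightarrow>
     (\<exists>(f' :: 'a \<Rightarrow> 'a \<Rightarrow>\<^sub>L 'b) (f'' :: 'a \<Rightarrow> 'a \<Rightarrow>\<^sub>L 'a \<Rightarrow>\<^sub>L 'b).
        (\<forall>x\<in>S. (f has_derivative blinfun_apply (f' x)) (at x within S)) \<and>
        (\<forall>x\<in>S. (f' has_derivative blinfun_apply (f'' x)) (at x within S)) \<and>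
        continuous_on S f'')"

text \<open>
  The mixed derivative on \<open>[0,T]\<^sup>2\<close>; restricting both difference quotients to \<open>[0,T]\<close> makes
  it one-sided on the boundary and independent of values outside the square.
\<close>

definition partial12 :: "real \<Rightarrow> (real \<times> real \<Rightarrow> real) \<Rightarrow> real \<times> real \<Rightarrow> real" where
  "partial12 T f = (\<lambda>(r1, r2).
     vector_derivative
       (\<lambda>x. vector_derivative (\<lambda>y. f (x, y)) (at r2 within {0..T}))
       (at r1 within {0..T}))"

text \<open>Words are lists over the finite letter type \<open>'d\<close>, so that \<open>d = CARD('d)\<close>.\<close>

function id_sig ::
  "real \<Rightarrow> (real \<times> real \<Rightarrow> real ^ 'd) \<Rightarrow> real \<times> real \<Rightarrow> real \<times> real \<Rightarrow> 'd list \<Rightarrow> real" where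
  "id_sig T X s t [] = 1"
| "id_sig T X s t (w @ [i]) =
     (LINT r : {fst s..fst t} \<times> {snd s..snd t} | lborel.
        id_sig T X s r w * partial12 T (\<lambda>p. X p $ i) r)"
  by (auto, metis rev_exhaust)
termination
  by (relation "Wellfounded.measure (\<lambda>(T, X, s, t, w). length w)") auto

definition delta1 ::
  "real \<Rightarrow> (real \<times> real \<Rightarrow> real \<times> real \<Rightarrow> 'd list \<Rightarrow> real) \<Rightarrow> real \<times> real \<Rightarrow> real \<times> real \<Rightarrow> 'd list \<Rightarrow> real" where
  "delta1 u S s t w = S s t w - S s (u, snd t) w - S (u, snd s) t w"

definition delta2 ::
  "real \<Rightarrow> (real \<times> real \<Rightarrow> real \<times> real \<Rightarrow> 'd list \<Rightarrow> real) \<Rightarrow> real \<times> real \<Rightarrow> real \<times> real \<Rightarrow> 'd list \<Rightarrow> real" where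
  "delta2 u S s t w = S s t w - S s (fst t, u) w - S (fst s, u) t w"

text \<open>
  The coordinates \<open>r\<^sup>1, \<dots>, r\<^sup>m\<close> are indexed by \<open>0, \<dots>, m - 1\<close>; values of \<open>r\<close> at other indices
  are ignored.
\<close>

definition ordered_simplex :: "nat \<Rightarrow> real \<Rightarrow> real \<Rightarrow> (nat \<Rightarrow> real) set" where
  "ordered_simplex m a b =
     {r. (\<forall>j<m. a \<le> r j \<and> r j \<le> b) \<and> (\<forall>i j. i \<le> j \<and> j < m \<longrightarrow> r i \<le> r j)}"

text \<open>
  An integration point is \<open>(r\<^sup>1, \<dots>, r\<^sup>m)\<close> with \<open>r\<^sup>j\<close> in the plane, integrated against the
  \<open>m\<close>-fold product of planar Lebesgue measure.  The left factor of a convolution is not just a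
  number: it enters through its lower corner \<open>p\<close>, its upper corner \<open>q\<close> and its word \<open>v\<close>.  The
  right factor is the function \<open>g\<close> of the coordinate marked by a dot, evaluated at the
  corresponding coordinate of \<open>r\<^sup>1\<close>.
\<close>

definition conv_domain :: "nat \<Rightarrow> real \<times> real \<Rightarrow> real \<times> real \<Rightarrow> (nat \<Rightarrow> real \<times> real) set" where
  "conv_domain m p q =
     {r. (\<lambda>j. fst (r j)) \<in> ordered_simplex m (fst p) (fst q) \<and>
         (\<lambda>j. snd (r j)) \<in> ordered_simplex m (snd p) (snd q)}"

definition conv1 ::
  "real \<Rightarrow> (real \<times> real \<Rightarrow> real ^ 'd) \<Rightarrow> real \<times> real \<Rightarrow> real \<times> real \<Rightarrow> 'd list \<Rightarrow> (real \<Rightarrow> real) \<Rightarrow> real" where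
  "conv1 T X p q v g =
     (LINT r : conv_domain (length v) p q | Pi\<^sub>M {..<length v} (\<lambda>_. lborel).
        g (snd (r 0)) * (\<Prod>j<length v. partial12 T (\<lambda>x. X x $ (v ! j)) (r j)))"

definition conv2 ::
  "real \<Rightarrow> (real \<times> real \<Rightarrow> real ^ 'd) \<Rightarrow> real \<times> real \<Rightarrow> real \<times> real \<Rightarrow> 'd list \<Rightarrow> (real \<Rightarrow> real) \<Rightarrow> real" where
  "conv2 T X p q v g =
     (LINT r : conv_domain (length v) p q | Pi\<^sub>M {..<length v} (\<lambda>_. lborel).
        g (fst (r 0)) * (\<Prod>j<length v. partial12 T (\<lambda>x. X x $ (v ! j)) (r j)))"

end

theory Submission
  imports Defs
begin

text \<open>
  Both directions are instances of one Chen-type identity.  Let the iterated integrals over boxes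
  start from an arbitrary function \<open>h\<close> in place of \<open>1\<close>, and let \<open>cut\<close> replace one
  coordinate of a point by \<open>u\<close>.  Splitting the outermost box along the hyperplane at \<open>u\<close> and
  inducting on the last letter, the signature of \<open>w\<close> over \<open>[s, t]\<close> becomes the sum over all
  \<open>k \<le> n\<close> of the iterated integrals of \<open>(w\<^sub>k\<^sub>+\<^sub>1, \<dots>, w\<^sub>n)\<close> over \<open>[cut s, t]\<close>, started from
  \<open>h r = S s (cut r) (w\<^sub>1, \<dots>, w\<^sub>k)\<close>.  The terms \<open>k = 0\<close> and \<open>k = n\<close> are those subtracted in
  \<open>\<delta>\<close>; the others are the convolution products by Fubini, since \<open>h r\<close> does not depend on the
  coordinate of \<open>r\<close> that is cut.
\<close>

section \<open>Iterated box integrals with a general initial function\<close>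

text \<open>The fold consumes the word from the left, so the last letter carries the outermost
  integral, as in \<open>id_sig\<close>, and \<open>h\<close> is the innermost integrand. Over a
  general Euclidean space, the two directions of the plane differ only by a basis vector.\<close>

definition iter_int ::
  "('d \<Rightarrow> 'a \<Rightarrow> real) \<Rightarrow> 'a::euclidean_space \<Rightarrow> 'd list \<Rightarrow> ('a \<Rightarrow> real) \<Rightarrow> 'a \<Rightarrow> real" where
  "iter_int f s w h = foldl (\<lambda>g i t. LINT r : cbox s t | lborel. g r * f i r) h w"

lemma iter_int_Nil [simp]: "iter_int f s [] h = h"
  by (simp add: iter_int_def)

lemma iter_int_snoc [simp]:
  "iter_int f s (w @ [i]) h t = (LINT r : cbox s t | lborel. iter_int f s w h r * f i r)"
  by (simp add: iter_int_def)

lemma integrable_bounded_mult: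
  fixes f g :: "'a \<Rightarrow> real"
  assumes "integrable M f" "g \<in> borel_measurable M" "bounded (range g)"
  shows "integrable M (\<lambda>x. g x * f x)"
proof -
  obtain B where B: "\<And>x. \<bar>g x\<bar> \<le> B"
    using assms(3) by (auto simp: bounded_iff)
  have "integrable M (\<lambda>x. B * \<bar>f x\<bar>)"
    using assms(1) by simp
  then show ?thesis
  proof (rule Bochner_Integration.integrable_bound)
    show "(\<lambda>x. g x * f x) \<in> borel_measurable M"
      using assms by measurable
    show "AE x in M. norm (g x * f x) \<le> norm (B * \<bar>f x\<bar>)"
      using B by (auto simp: abs_mult intro!: mult_right_mono order_trans[OF B])
  qed
qed

lemma measurable_pred_cbox [measurable]:
  fixes F G H :: "'b \<Rightarrow> 'a::euclidean_space"
  assumes [measurable]: "F \<in> borel_measurable M" "G \<in> borel_measurable M" "H \<in> borel_measurable M"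
  shows "Measurable.pred M (\<lambda>x. F x \<in> cbox (G x) (H x))"
  unfolding mem_box by measurable

text \<open>Membership of \<open>r\<close> in \<open>cbox s t\<close> is jointly measurable in
  \<open>t\<close> and \<open>r\<close>, so the integral is measurable in the upper corner. The L1
  norm of \<open>\<phi>\<close> bounds it uniformly.\<close>

lemma integral_cbox_measurable_bounded:
  fixes \<phi> :: "'a::euclidean_space \<Rightarrow> real"
  assumes "integrable lborel \<phi>"
  shows "(\<lambda>t. LINT r : cbox s t | lborel. \<phi> r) \<in> borel_measurable borel"
    and "bounded (range (\<lambda>t. LINT r : cbox s t | lborel. \<phi> r))"
proof -
  have [measurable]: "\<phi> \<in> borel_measurable borel"
    using borel_measurable_integrable[OF assms] by simp
  show "(\<lambda>t. LINT r : cbox s t | lborel. \<phi> r) \<in> borel_measurable borel"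
    unfolding set_lebesgue_integral_def indicator_def by measurable
  have "\<bar>LINT r : cbox s t | lborel. \<phi> r\<bar> \<le> (\<integral>r. \<bar>\<phi> r\<bar> \<partial>lborel)" for t
    unfolding set_lebesgue_integral_def
    by (rule order_trans[OF integral_abs_bound integral_mono'])
       (use assms in \<open>auto simp: abs_mult indicator_def\<close>)
  then show "bounded (range (\<lambda>t. LINT r : cbox s t | lborel. \<phi> r))"
    by (auto simp: bounded_iff)
qed

text \<open>Measurability and boundedness survive each further integration, so every integrand in
  the iteration is a bounded function times an integrable density.\<close>

lemma iter_int_measurable_bounded:
  assumes "\<And>i. integrable lborel (f i)" "h \<in> borel_measurable borel" "bounded (range h)"
  shows "iter_int f s w h \<in> borel_measurable borel \<and> bounded (range (iter_int f s w h))"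
proof (induction w rule: rev_induct)
  case Nil
  then show ?case using assms by simp
next
  case (snoc i w)
  have "integrable lborel (\<lambda>r. iter_int f s w h r * f i r)"
    using snoc assms by (intro integrable_bounded_mult) auto
  from integral_cbox_measurable_bounded[OF this] show ?case
    unfolding iter_int_snoc[abs_def] by blast
qed

lemma integrable_iter_int_mult:
  assumes "\<And>i. integrable lborel (f i)" "h \<in> borel_measurable borel" "bounded (range h)"
  shows "integrable lborel (\<lambda>r. iter_int f s w h r * f i r)"
  using iter_int_measurable_bounded[of f h s w, OF assms] assms by (intro integrable_bounded_mult) auto

section \<open>Cutting a box along a hyperplane and the Chen-type identity\<close>

definition cut :: "'a \<Rightarrow> real \<Rightarrow> 'a \<Rightarrow> 'a::euclidean_space" where
  "cut e u x = x + (u - x \<bullet> e) *\<^sub>R e"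

lemma cut_inner:
  assumes "e \<in> Basis" "b \<in> Basis"
  shows "cut e u x \<bullet> b = (if b = e then u else x \<bullet> b)"
  using assms by (auto simp: cut_def inner_add_left inner_Basis)

lemma cut_measurable [measurable]: "cut e u \<in> borel_measurable borel"
  unfolding cut_def[abs_def] by measurable

text \<open>The two halves of the box meet only inside the hyperplane
  \<open>x \<bullet> e = u\<close>, which is a null set.\<close>

lemma set_integral_cbox_cut:
  fixes \<phi> :: "'a::euclidean_space \<Rightarrow> real"
  assumes e: "e \<in> Basis" and u: "s \<bullet> e \<le> u" "u \<le> t \<bullet> e" and int: "integrable lborel \<phi>"
  shows "(LINT r : cbox s t | lborel. \<phi> r) =
    (LINT r : cbox s (cut e u t) | lborel. \<phi> r) + (LINT r : cbox (cut e u s) t | lborel. \<phi> r)"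
proof -
  have "cbox s t = cbox s (cut e u t) \<union> cbox (cut e u s) t"
  proof (rule set_eqI)
    fix x
    have "x \<in> cbox s t \<longleftrightarrow> s \<bullet> e \<le> x \<bullet> e \<and> x \<bullet> e \<le> t \<bullet> e \<and>
        (\<forall>i\<in>Basis - {e}. s \<bullet> i \<le> x \<bullet> i \<and> x \<bullet> i \<le> t \<bullet> i)"
      using e by (auto simp: mem_box)
    moreover have "x \<in> cbox s (cut e u t) \<longleftrightarrow> s \<bullet> e \<le> x \<bullet> e \<and> x \<bullet> e \<le> u \<and>
        (\<forall>i\<in>Basis - {e}. s \<bullet> i \<le> x \<bullet> i \<and> x \<bullet> i \<le> t \<bullet> i)"
      using e by (auto simp: mem_box cut_inner)
    moreover have "x \<in> cbox (cut e u s) t \<longleftrightarrow> u \<le> x \<bullet> e \<and> x \<bullet> e \<le> t \<bullet> e \<and>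
        (\<forall>i\<in>Basis - {e}. s \<bullet> i \<le> x \<bullet> i \<and> x \<bullet> i \<le> t \<bullet> i)"
      using e by (auto simp: mem_box cut_inner)
    ultimately show "x \<in> cbox s t \<longleftrightarrow> x \<in> cbox s (cut e u t) \<union> cbox (cut e u s) t"
      using u by force
  qed
  moreover have "(LINT r : cbox s (cut e u t) \<union> cbox (cut e u s) t | lborel. \<phi> r) =
    (LINT r : cbox s (cut e u t) | lborel. \<phi> r) + (LINT r : cbox (cut e u s) t | lborel. \<phi> r)"
  proof (rule set_integral_Un_AE)
    have "{x. x \<bullet> e = u} \<in> null_sets lborel"
      using negligible_standard_hyperplane[OF e, of u]
      by (simp add: negligible_iff_null_sets null_sets_completion_iff)
    then have "AE x in lborel. x \<notin> {x. x \<bullet> e = u}"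
      by (rule AE_not_in)
    then show "AE x in lborel. \<not> (x \<in> cbox s (cut e u t) \<and> x \<in> cbox (cut e u s) t)"
      by eventually_elim (use e in \<open>force simp: mem_box cut_inner\<close>)
  qed (use int in \<open>auto simp: set_integrable_def intro: integrable_mult_indicator[where 'b = real, simplified]\<close>)
  ultimately show ?thesis by simp
qed

lemma iter_int_chen_cut:
  fixes f :: "'d \<Rightarrow> 'a::euclidean_space \<Rightarrow> real"
  assumes f: "\<And>i. integrable lborel (f i)" and e: "e \<in> Basis"
    and "s \<bullet> e \<le> u" "u \<le> t \<bullet> e"
  shows "iter_int f s w (\<lambda>_. 1) t =
    (\<Sum>k\<le>length w. iter_int f (cut e u s) (drop k w)
       (\<lambda>r. iter_int f s (take k w) (\<lambda>_. 1) (cut e u r)) t)"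
  using assms(4)
proof (induction w arbitrary: t rule: rev_induct)
  case Nil
  then show ?case by simp
next
  case (snoc i w)
  let ?S = "\<lambda>w. iter_int f s w (\<lambda>_. 1)"
  let ?K = "\<lambda>k w. iter_int f (cut e u s) (drop k w) (\<lambda>r. ?S (take k w) (cut e u r))"
  have int: "integrable lborel (\<lambda>r. ?K k w r * f i r)" for k
  proof (rule integrable_iter_int_mult[OF f])
    have S: "?S (take k w) \<in> borel_measurable borel" "bounded (range (?S (take k w)))"
      using iter_int_measurable_bounded[of f "\<lambda>_. 1" s "take k w", OF f] by auto
    then show "(\<lambda>r. ?S (take k w) (cut e u r)) \<in> borel_measurable borel"
      by measurable
    show "bounded (range (\<lambda>r. ?S (take k w) (cut e u r)))"
      using S(2) by (rule bounded_subset) auto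
  qed
  \<comment> \<open>The lower half is already the summand for \<open>k = length (w @ [i])\<close>,
    where \<open>drop\<close> leaves the empty word. Only the upper half needs the induction
    hypothesis.\<close>
  have "?S (w @ [i]) t = ?S (w @ [i]) (cut e u t) +
      (LINT r : cbox (cut e u s) t | lborel. ?S w r * f i r)"
    unfolding iter_int_snoc using snoc.prems assms
    by (intro set_integral_cbox_cut integrable_iter_int_mult) auto
  also have "(LINT r : cbox (cut e u s) t | lborel. ?S w r * f i r) =
      (LINT r : cbox (cut e u s) t | lborel. (\<Sum>k\<le>length w. ?K k w r * f i r))"
  proof (rule set_lebesgue_integral_cong)
    show "\<forall>r. r \<in> cbox (cut e u s) t \<longrightarrow> ?S w r * f i r = (\<Sum>k\<le>length w. ?K k w r * f i r)"
    proof (intro allI impI)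
      \<comment> \<open>The induction hypothesis is applied at the integration point
        \<open>r\<close> in place of \<open>t\<close>, which is legitimate because \<open>r\<close>
        lies above the cut.\<close>
      fix r assume "r \<in> cbox (cut e u s) t"
      then have "u \<le> r \<bullet> e"
        using e by (auto simp: mem_box cut_inner)
      from snoc.IH[OF this] show "?S w r * f i r = (\<Sum>k\<le>length w. ?K k w r * f i r)"
        by (simp add: sum_distrib_right)
    qed
  qed simp
  also have "\<dots> = (\<Sum>k\<le>length w. LINT r : cbox (cut e u s) t | lborel. ?K k w r * f i r)"
    unfolding set_lebesgue_integral_def scaleR_sum_right using int
    by (intro Bochner_Integration.integral_sum integrable_mult_indicator) auto
  also have "\<dots> = (\<Sum>k\<le>length w. ?K k (w @ [i]) t)"
    by (intro sum.cong) auto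
  finally show ?case by simp
qed

section \<open>Iterated integrals as single integrals over chains of points\<close>

text \<open>These are the chains \<open>p \<le> r 0 \<le> \<dots> \<le> r (m - 1) \<le> q\<close> in
  the componentwise order. Written with nested boxes, the last point can be peeled off and becomes
  the upper corner for the remaining ones.\<close>

definition box_chain :: "nat \<Rightarrow> 'a::euclidean_space \<Rightarrow> 'a \<Rightarrow> (nat \<Rightarrow> 'a) set" where
  "box_chain m p q = {r. \<forall>j<m. r j \<in> cbox p (if Suc j = m then q else r (Suc j))}"

lemma box_chain_Suc:
  "r \<in> box_chain (Suc m) p q \<longleftrightarrow> r m \<in> cbox p q \<and> r \<in> box_chain m p (r m)"
  by (auto simp: box_chain_def less_Suc_eq)

lemma box_chain_cong:
  "(\<And>j. j < m \<Longrightarrow> r j = r' j) \<Longrightarrow> r \<in> box_chain m p q \<longleftrightarrow> r' \<in> box_chain m p q"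
  by (auto simp: box_chain_def)

text \<open>Fubini with the last coordinate outermost, matching the order of integration in
  \<open>iter_int\<close>.\<close>

lemma integral_PiM_Suc:
  fixes F :: "(nat \<Rightarrow> 'a::euclidean_space) \<Rightarrow> real"
  assumes "integrable (Pi\<^sub>M {..<Suc m} (\<lambda>_. lborel)) F"
  shows "(\<integral>r. F r \<partial>Pi\<^sub>M {..<Suc m} (\<lambda>_. lborel)) =
    (\<integral>x. (\<integral>y. F (y(m := x)) \<partial>Pi\<^sub>M {..<m} (\<lambda>_. lborel)) \<partial>lborel)"
proof -
  interpret product_sigma_finite "\<lambda>_::nat. lborel :: 'a measure"
    by standard
  have eq: "{..<Suc m} = {m} \<union> {..<m}" by auto
  have "(\<integral>r. F r \<partial>Pi\<^sub>M {..<Suc m} (\<lambda>_. lborel)) =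
    (\<integral>x. (\<integral>y. F (merge {m} {..<m} (x, y)) \<partial>Pi\<^sub>M {..<m} (\<lambda>_. lborel)) \<partial>Pi\<^sub>M {m} (\<lambda>_. lborel))"
    using assms unfolding eq by (intro product_integral_fold) auto
  also have "\<dots> = (\<integral>x. (\<integral>y. F (y(m := x m)) \<partial>Pi\<^sub>M {..<m} (\<lambda>_. lborel)) \<partial>Pi\<^sub>M {m} (\<lambda>_. lborel))"
  proof (intro Bochner_Integration.integral_cong refl)
    \<comment> \<open>Points of the product space are undefined outside the index set, and so is
      \<open>merge\<close>. Hence merging is a plain function update.\<close>
    fix x y assume "y \<in> space (Pi\<^sub>M {..<m} (\<lambda>_. lborel :: 'a measure))"
    then have "merge {m} {..<m} (x, y) = y(m := x m)"
      by (auto simp: merge_def space_PiM PiE_def extensional_def)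
    then show "F (merge {m} {..<m} (x, y)) = F (y(m := x m))" by simp
  qed
  also have "\<dots> = (\<integral>x. (\<integral>y. F (y(m := x)) \<partial>Pi\<^sub>M {..<m} (\<lambda>_. lborel)) \<partial>lborel)"
  proof (rule product_integral_singleton)
    interpret finite_product_sigma_finite "\<lambda>_::nat. lborel :: 'a measure" "{..<m}"
      by standard auto
    have "F \<in> borel_measurable (Pi\<^sub>M (insert m {..<m}) (\<lambda>_. lborel))"
      using borel_measurable_integrable[OF assms] by (simp add: lessThan_Suc)
    then have "(\<lambda>(x, y). F (y(m := x)))
      \<in> borel_measurable (lborel \<Otimes>\<^sub>M Pi\<^sub>M {..<m} (\<lambda>_. lborel))"
      by measurable
    then show "(\<lambda>x. \<integral>y. F (y(m := x)) \<partial>Pi\<^sub>M {..<m} (\<lambda>_. lborel)) \<in> borel_measurable lborel"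
      by (rule borel_measurable_lebesgue_integral)
  qed
  finally show ?thesis .
qed

text \<open>A product of integrable functions of separate coordinates is integrable on the product
  space; the indicator and \<open>h\<close> contribute a bounded measurable factor. Positivity of
  \<open>m\<close> makes \<open>r 0\<close> an actual coordinate.\<close>

lemma integrable_box_chain:
  fixes f :: "'d \<Rightarrow> 'a::euclidean_space \<Rightarrow> real"
  assumes f: "\<And>i. integrable lborel (f i)"
    and h: "h \<in> borel_measurable borel" "bounded (range h)" and m: "0 < m"
  shows "integrable (Pi\<^sub>M {..<m} (\<lambda>_. lborel))
    (\<lambda>r. indicator (box_chain m p q) r *\<^sub>R (h (r 0) * (\<Prod>j<m. f (v ! j) (r j))))"
proof -
  interpret product_sigma_finite "\<lambda>_::nat. lborel :: 'a measure"
    by standard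
  note [measurable] = h(1)
  have component [measurable]:
    "(\<lambda>r. r j) \<in> borel_measurable (Pi\<^sub>M {..<m} (\<lambda>_. lborel :: 'a measure))" if "j < m" for j
    using measurable_component_singleton[of j "{..<m}" "\<lambda>_. lborel :: 'a measure"] that by simp
  have "integrable (Pi\<^sub>M {..<m} (\<lambda>_. lborel))
     (\<lambda>r. (indicator (box_chain m p q) r * h (r 0)) * (\<Prod>j<m. f (v ! j) (r j)))"
  proof (rule integrable_bounded_mult)
    show "integrable (Pi\<^sub>M {..<m} (\<lambda>_. lborel)) (\<lambda>r. \<Prod>j<m. f (v ! j) (r j))"
      using f by (intro product_integrable_prod) auto
    have "(\<lambda>r. if Suc j = m then q else r (Suc j))
        \<in> borel_measurable (Pi\<^sub>M {..<m} (\<lambda>_. lborel))" if "j < m" for j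
      using that component[of "Suc j"] by (cases "Suc j = m") auto
    then have "Measurable.pred (Pi\<^sub>M {..<m} (\<lambda>_. lborel))
        (\<lambda>r. \<forall>j\<in>{..<m}. r j \<in> cbox p (if Suc j = m then q else r (Suc j)))"
      by (intro pred_intros_finite measurable_pred_cbox) (auto intro!: component)
    then have [measurable]: "Measurable.pred (Pi\<^sub>M {..<m} (\<lambda>_. lborel)) (\<lambda>r. r \<in> box_chain m p q)"
      unfolding box_chain_def Ball_def lessThan_iff mem_Collect_eq .
    show "(\<lambda>r. indicator (box_chain m p q) r * h (r 0))
      \<in> borel_measurable (Pi\<^sub>M {..<m} (\<lambda>_. lborel))"
      unfolding indicator_def using component[OF m] by measurable
    obtain B where B: "\<And>x. \<bar>h x\<bar> \<le> B"
      using h(2) by (auto simp: bounded_iff)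
    have "\<bar>indicator (box_chain m p q) r * h (r 0)\<bar> \<le> B" for r
      using B[of "r 0"] by (auto simp: indicator_def)
    then show "bounded (range (\<lambda>r. indicator (box_chain m p q) r * h (r 0)))"
      unfolding bounded_iff by auto
  qed
  then show ?thesis by (simp add: mult.assoc)
qed

text \<open>Induction on the last letter: its point is integrated outermost by Fubini, and the inner
  integral is the induction hypothesis with that point as upper corner.\<close>

lemma iter_int_eq_integral_box_chain:
  fixes f :: "'d \<Rightarrow> 'a::euclidean_space \<Rightarrow> real"
  assumes f: "\<And>i. integrable lborel (f i)"
    and h: "h \<in> borel_measurable borel" "bounded (range h)" and "v \<noteq> []"
  shows "iter_int f p v h q =
    (LINT r : box_chain (length v) p q | Pi\<^sub>M {..<length v} (\<lambda>_. lborel).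
       h (r 0) * (\<Prod>j<length v. f (v ! j) (r j)))"
  using assms(4)
proof (induction v arbitrary: q rule: rev_nonempty_induct)
  case (single i)
  let ?F = "\<lambda>r. indicator (box_chain 1 p q) r *\<^sub>R (h (r 0) * (\<Prod>j<1. f ([i] ! j) (r j)))"
  interpret product_sigma_finite "\<lambda>_::nat. lborel :: 'a measure"
    by standard
  have "(\<integral>r. ?F r \<partial>Pi\<^sub>M {..<Suc 0} (\<lambda>_. lborel)) =
      (\<integral>x. (\<integral>y. ?F (y(0 := x)) \<partial>Pi\<^sub>M {..<0} (\<lambda>_. lborel)) \<partial>lborel)"
    using integrable_box_chain[OF f h, of 1] by (intro integral_PiM_Suc) auto
  \<comment> \<open>The product over the empty index set is counting measure on a single point, so
    the inner integral is just evaluation.\<close>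
  then show ?case
    by (simp add: set_lebesgue_integral_def iter_int_snoc[of _ _ "[]", simplified]
        PiM_empty lebesgue_integral_count_space_finite box_chain_def indicator_def)
next
  case (snoc i v)
  let ?m = "length v"
  let ?P = "\<lambda>r. h (r 0) * (\<Prod>j<?m. f (v ! j) (r j))"
  let ?F = "\<lambda>r. indicator (box_chain (Suc ?m) p q) r *\<^sub>R
    (h (r 0) * (\<Prod>j<Suc ?m. f ((v @ [i]) ! j) (r j)))"
  have F: "?F (y(?m := x)) = indicator (cbox p q) x *\<^sub>R
      ((indicator (box_chain ?m p x) y *\<^sub>R ?P y) * f i x)" for x y
  proof -
    have "y(?m := x) \<in> box_chain (Suc ?m) p q \<longleftrightarrow> x \<in> cbox p q \<and> y \<in> box_chain ?m p x"
      by (simp add: box_chain_Suc box_chain_cong[of ?m "y(?m := x)" y])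
    moreover have "(\<Prod>j<Suc ?m. f ((v @ [i]) ! j) ((y(?m := x)) j)) = (\<Prod>j<?m. f (v ! j) (y j)) * f i x"
      by (simp add: nth_append)
    \<comment> \<open>Since \<open>v\<close> is nonempty, index \<open>0\<close> differs from the
      updated index \<open>?m\<close>, so \<open>h\<close> still sees \<open>y 0\<close>.\<close>
    ultimately show ?thesis
      using snoc.hyps by (simp add: indicator_def)
  qed
  have "(\<integral>r. ?F r \<partial>Pi\<^sub>M {..<Suc ?m} (\<lambda>_. lborel)) =
      (\<integral>x. (\<integral>y. ?F (y(?m := x)) \<partial>Pi\<^sub>M {..<?m} (\<lambda>_. lborel)) \<partial>lborel)"
    by (intro integral_PiM_Suc integrable_box_chain f h) simp
  also have "\<dots> = (\<integral>x. indicator (cbox p q) x *\<^sub>R (iter_int f p v h x * f i x) \<partial>lborel)"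
    unfolding F using snoc.IH by (simp add: set_lebesgue_integral_def)
  finally show ?case
    by (simp add: set_lebesgue_integral_def)
qed

section \<open>Continuity of the mixed derivative\<close>

text \<open>Restricting the Frechet derivatives to axis-parallel slices identifies the mixed
  derivative with the \<open>i\<close>-th component of \<open>f'' p (1, 0) (0, 1)\<close>, which is
  continuous in \<open>p\<close>. One-sided derivatives at the ends of the interval are unique
  because \<open>T > 0\<close>.\<close>

lemma partial12_continuous_on:
  fixes X :: "real \<times> real \<Rightarrow> real ^ 'd"
  assumes T: "T > 0" and X: "C2_on ({0..T} \<times> {0..T}) X"
  shows "continuous_on ({0..T} \<times> {0..T}) (partial12 T (\<lambda>p. X p $ i))"
proof -
  let ?Q = "{0..T} \<times> {0..T}"
  obtain f' :: "real \<times> real \<Rightarrow> ((real \<times> real) \<Rightarrow>\<^sub>L (real ^ 'd))"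
      and f'' :: "real \<times> real \<Rightarrow> ((real \<times> real) \<Rightarrow>\<^sub>L ((real \<times> real) \<Rightarrow>\<^sub>L (real ^ 'd)))" where
    f': "\<And>x. x \<in> ?Q \<Longrightarrow> (X has_derivative blinfun_apply (f' x)) (at x within ?Q)" and
    f'': "\<And>x. x \<in> ?Q \<Longrightarrow> (f' has_derivative blinfun_apply (f'' x)) (at x within ?Q)" and
    cont: "continuous_on ?Q f''"
    using X unfolding C2_on_def by blast
  have d2: "vector_derivative (\<lambda>y. X (x, y) $ i) (at y within {0..T}) = f' (x, y) (0, 1) $ i"
    if x: "x \<in> {0..T}" and y: "y \<in> {0..T}" for x y
  proof (rule vector_derivative_within_closed_interval[OF T y])
    have "((\<lambda>y. X (x, y)) has_derivative (\<lambda>h. f' (x, y) (0, h))) (at y within {0..T})"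
      by (rule has_derivative_in_compose2[where g = X and f = "\<lambda>y. (x, y)" and t = ?Q, OF f'])
         (use x y in \<open>auto intro!: derivative_eq_intros\<close>)
    from bounded_linear.has_derivative[OF bounded_linear_vec_nth this]
    have deriv: "((\<lambda>y. X (x, y) $ i) has_derivative (\<lambda>h. f' (x, y) (0, h) $ i)) (at y within {0..T})" .
    have "f' (x, y) (0, h) $ i = h *\<^sub>R (f' (x, y) (0, 1) $ i)" for h
      using blinfun.scaleR_right[of "f' (x, y)" h "(0, 1)"] by simp
    then have "(\<lambda>h. f' (x, y) (0, h) $ i) = (\<lambda>h. h *\<^sub>R (f' (x, y) (0, 1) $ i))"
      by (rule ext)
    from deriv[unfolded this] show "((\<lambda>y. X (x, y) $ i) has_vector_derivative f' (x, y) (0, 1) $ i) (at y within {0..T})"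
      by (simp add: has_vector_derivative_def)
  qed
  have d12: "partial12 T (\<lambda>p. X p $ i) (x, y) = f'' (x, y) (1, 0) (0, 1) $ i"
    if x: "x \<in> {0..T}" and y: "y \<in> {0..T}" for x y
    unfolding partial12_def prod.case
  proof (rule vector_derivative_within_closed_interval[OF T x])
    have "((\<lambda>x. f' (x, y)) has_derivative (\<lambda>h. f'' (x, y) (h, 0))) (at x within {0..T})"
      by (rule has_derivative_in_compose2[where g = f' and f = "\<lambda>x. (x, y)" and t = ?Q, OF f''])
         (use x y in \<open>auto intro!: derivative_eq_intros\<close>)
    then have "((\<lambda>x. f' (x, y) (0, 1)) has_derivative (\<lambda>h. f'' (x, y) (h, 0) (0, 1))) (at x within {0..T})"
      by (rule bounded_linear.has_derivative[OF blinfun.bounded_linear_left])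
    from bounded_linear.has_derivative[OF bounded_linear_vec_nth this]
    have deriv: "((\<lambda>x. f' (x, y) (0, 1) $ i) has_derivative (\<lambda>h. f'' (x, y) (h, 0) (0, 1) $ i))
        (at x within {0..T})" .
    have "f'' (x, y) (h, 0) (0, 1) $ i = h *\<^sub>R (f'' (x, y) (1, 0) (0, 1) $ i)" for h
      using blinfun.scaleR_right[of "f'' (x, y)" h "(1, 0)"] by (simp add: blinfun.scaleR_left)
    then have "(\<lambda>h. f'' (x, y) (h, 0) (0, 1) $ i) = (\<lambda>h. h *\<^sub>R (f'' (x, y) (1, 0) (0, 1) $ i))"
      by (rule ext)
    from deriv[unfolded this] have "((\<lambda>x. f' (x, y) (0, 1) $ i) has_vector_derivative
        f'' (x, y) (1, 0) (0, 1) $ i) (at x within {0..T})"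
      by (simp add: has_vector_derivative_def)
    \<comment> \<open>The inner derivative equals \<open>f' (x, y) (0, 1) $ i\<close> for every
      \<open>x\<close> in the interval, so it may be replaced before differentiating in
      \<open>x\<close>.\<close>
    then show "((\<lambda>x. vector_derivative (\<lambda>y. X (x, y) $ i) (at y within {0..T}))
        has_vector_derivative f'' (x, y) (1, 0) (0, 1) $ i) (at x within {0..T})"
      by (rule has_vector_derivative_transform[rotated 2]) (use x y d2 in auto)
  qed
  have "continuous_on ?Q (\<lambda>p. f'' p (1, 0) (0, 1) $ i)"
    using cont by (intro continuous_intros)
  then show ?thesis
    by (rule continuous_on_eq) (auto simp: d12)
qed

section \<open>Specialisation to the plane: convolutions and signatures as iterated box
  integrals\<close>

lemma ordered_simplex_Suc:
  "r \<in> ordered_simplex (Suc m) a b \<longleftrightarrow> a \<le> r m \<and> r m \<le> b \<and> r \<in> ordered_simplex m a (r m)"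
proof -
  have "(\<forall>i j. i \<le> j \<and> j < Suc m \<longrightarrow> r i \<le> r j) \<longleftrightarrow>
      (\<forall>i j. i \<le> j \<and> j < m \<longrightarrow> r i \<le> r j) \<and> (\<forall>i<m. r i \<le> r m)"
    by (auto simp: less_Suc_eq le_less)
  then show ?thesis
    unfolding ordered_simplex_def mem_Collect_eq All_less_Suc using order_trans[of _ "r m" b] by blast
qed

text \<open>Two coordinatewise increasing sequences form one chain in the componentwise order of the
  plane.\<close>

lemma conv_domain_eq_box_chain: "conv_domain m p q = box_chain m p q"
proof -
  have "r \<in> conv_domain m p q \<longleftrightarrow> r \<in> box_chain m p q" for r
  proof (induction m arbitrary: q)
    case 0
    then show ?case by (simp add: conv_domain_def ordered_simplex_def box_chain_def)
  next
    case (Suc m)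
    have "r \<in> conv_domain (Suc m) p q \<longleftrightarrow> r m \<in> cbox p q \<and> r \<in> conv_domain m p (r m)"
      by (cases p; cases q; cases "r m")
         (auto simp: conv_domain_def ordered_simplex_Suc cbox_Pair_eq)
    then show ?case by (simp add: Suc.IH box_chain_Suc)
  qed
  then show ?thesis by blast
qed

text \<open>
  Cutting the density off outside the square makes it integrable on the whole plane, so that the
  general results apply with no condition on where the corners lie.
\<close>

definition mixed_density ::
  "real \<Rightarrow> (real \<times> real \<Rightarrow> real ^ 'd) \<Rightarrow> 'd \<Rightarrow> real \<times> real \<Rightarrow> real" where
  "mixed_density T X i r = indicator ({0..T} \<times> {0..T}) r *\<^sub>R partial12 T (\<lambda>p. X p $ i) r"

lemma integrable_mixed_density:
  assumes "T > 0" "C2_on ({0..T} \<times> {0..T}) X"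
  shows "integrable lborel (mixed_density T X i)"
  unfolding mixed_density_def[abs_def]
  by (intro borel_integrable_compact compact_Times partial12_continuous_on assms) auto

lemma cbox_subset_square:
  fixes p q :: "real \<times> real"
  assumes "p \<in> {0..T} \<times> {0..T}" "q \<in> {0..T} \<times> {0..T}"
  shows "cbox p q \<subseteq> {0..T} \<times> {0..T}"
  using assms by (cases p; cases q) (auto simp: cbox_Pair_eq)

text \<open>A box with both corners in the square stays inside it, so the cut-off in
  \<open>mixed_density\<close> is invisible at every level of the recursion.\<close>

lemma id_sig_eq_iter_int:
  assumes s: "s \<in> {0..T} \<times> {0..T}" and t: "t \<in> {0..T} \<times> {0..T}"
  shows "id_sig T X s t w = iter_int (mixed_density T X) s w (\<lambda>_. 1) t"
  using t
proof (induction w arbitrary: t rule: rev_induct)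
  case Nil
  then show ?case by simp
next
  case (snoc i w)
  have "{fst s..fst t} \<times> {snd s..snd t} = cbox s t"
    by (cases s; cases t) (simp add: cbox_Pair_eq)
  then show ?case
    using cbox_subset_square[OF s snoc.prems]
    by (auto simp: snoc.IH mixed_density_def intro!: set_lebesgue_integral_cong)
qed

lemma box_chain_subset_cbox:
  assumes "r \<in> box_chain m p q" "j < m"
  shows "r j \<in> cbox p q"
  using assms
proof (induction m arbitrary: q)
  case (Suc m)
  then have "r m \<in> cbox p q" "j = m \<or> r j \<in> cbox p (r m)"
    by (auto simp: box_chain_Suc less_Suc_eq)
  then show ?case by (auto simp: mem_box intro: order_trans)
qed simp

text \<open>Here \<open>G\<close> stands for a signature, which is identified with the measurable
  bounded function \<open>h\<close> on the square only. This suffices, since every point of a chain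
  from \<open>p\<close> to \<open>q\<close> lies in the square.\<close>

lemma conv_integral_eq_iter_int:
  fixes G h :: "real \<times> real \<Rightarrow> real"
  assumes T: "T > 0" and X: "C2_on ({0..T} \<times> {0..T}) X"
    and p: "p \<in> {0..T} \<times> {0..T}" and q: "q \<in> {0..T} \<times> {0..T}" and v: "v \<noteq> []"
    and h: "h \<in> borel_measurable borel" "bounded (range h)"
    and G: "\<And>r. r \<in> {0..T} \<times> {0..T} \<Longrightarrow> G r = h r"
  shows "(LINT r : conv_domain (length v) p q | Pi\<^sub>M {..<length v} (\<lambda>_. lborel).
      G (r 0) * (\<Prod>j<length v. partial12 T (\<lambda>x. X x $ (v ! j)) (r j))) =
    iter_int (mixed_density T X) p v h q"
proof -
  have eq: "G (r 0) * (\<Prod>j<length v. partial12 T (\<lambda>x. X x $ (v ! j)) (r j)) =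
      h (r 0) * (\<Prod>j<length v. mixed_density T X (v ! j) (r j))"
    if "r \<in> box_chain (length v) p q" for r
  proof -
    have Q: "r j \<in> {0..T} \<times> {0..T}" if "j < length v" for j
      using box_chain_subset_cbox[OF \<open>r \<in> _\<close> that] cbox_subset_square[OF p q] by blast
    then show ?thesis
      using v by (simp add: G mixed_density_def)
  qed
  show ?thesis
    unfolding iter_int_eq_integral_box_chain[of "mixed_density T X", OF integrable_mixed_density[OF T X] h v]
      conv_domain_eq_box_chain set_lebesgue_integral_def
    by (intro Bochner_Integration.integral_cong refl) (simp add: indicator_def eq)
qed

section \<open>The identity for both directions\<close>

text \<open>This is the common form of both claims, with the direction given by \<open>e\<close>.
  The assumption on \<open>cut\<close> keeps the moved corners in the square, where signatures are
  iterated integrals of \<open>mixed_density\<close>.\<close>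

lemma delta_id_sig:
  fixes X :: "real \<times> real \<Rightarrow> real ^ 'd"
  assumes T: "T > 0" and X: "C2_on ({0..T} \<times> {0..T}) X" and w: "w \<noteq> []"
    and s: "s \<in> {0..T} \<times> {0..T}" and t: "t \<in> {0..T} \<times> {0..T}"
    and e: "e \<in> Basis" and u: "s \<bullet> e \<le> u" "u \<le> t \<bullet> e"
    and cut: "\<And>r. r \<in> {0..T} \<times> {0..T} \<Longrightarrow> cut e u r \<in> {0..T} \<times> {0..T}"
  shows "id_sig T X s t w - id_sig T X s (cut e u t) w - id_sig T X (cut e u s) t w =
    (\<Sum>k = 1..length w - 1.
       LINT r : conv_domain (length (drop k w)) (cut e u s) t | Pi\<^sub>M {..<length (drop k w)} (\<lambda>_. lborel).
         id_sig T X s (cut e u (r 0)) (take k w) *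
         (\<Prod>j<length (drop k w). partial12 T (\<lambda>x. X x $ (drop k w ! j)) (r j)))"
    (is "_ = (\<Sum>k = 1..length w - 1. ?C k)")
proof -
  let ?f = "mixed_density T X"
  let ?h = "\<lambda>k r. iter_int ?f s (take k w) (\<lambda>_. 1) (cut e u r)"
  let ?K = "\<lambda>k. iter_int ?f (cut e u s) (drop k w) (?h k) t"
  note f = integrable_mixed_density[OF T X]
  obtain n where n: "length w = Suc n"
    using w by (cases w) auto
  have "id_sig T X s t w = (\<Sum>k\<le>Suc n. ?K k)"
    unfolding id_sig_eq_iter_int[OF s t] n[symmetric]
    using f e u by (intro iter_int_chen_cut) auto
  \<comment> \<open>The word has length \<open>Suc n\<close>. At \<open>k = 0\<close> the initial
    function is constantly \<open>1\<close>; at \<open>k = Suc n\<close> no letters remain to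
    integrate, so only \<open>?h\<close> at \<open>t\<close> is left.\<close>
  also have "\<dots> = ?K 0 + (\<Sum>k = 1..n. ?K k) + ?K (Suc n)"
    by (simp add: atMost_atLeast0 sum.atLeast_Suc_atMost)
  also have "?K 0 = id_sig T X (cut e u s) t w"
    by (simp add: id_sig_eq_iter_int[OF cut[OF s] t, of X])
  also have "?K (Suc n) = id_sig T X s (cut e u t) w"
    by (simp add: id_sig_eq_iter_int[OF s cut[OF t], of X] n)
  also have "(\<Sum>k = 1..n. ?K k) = (\<Sum>k = 1..n. ?C k)"
  proof (rule sum.cong)
    fix k assume "k \<in> {1..n}"
    have S: "iter_int ?f s (take k w) (\<lambda>_. 1) \<in> borel_measurable borel"
      "bounded (range (iter_int ?f s (take k w) (\<lambda>_. 1)))"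
      using iter_int_measurable_bounded[of ?f "\<lambda>_. 1" s "take k w", OF f] by auto
    have "?C k = ?K k"
    proof (rule conv_integral_eq_iter_int[OF T X cut[OF s] t])
      show "drop k w \<noteq> []"
        using \<open>k \<in> {1..n}\<close> n by auto
      show "?h k \<in> borel_measurable borel"
        using S(1) by measurable
      show "bounded (range (?h k))"
        using S(2) by (rule bounded_subset) auto
    qed (use s cut in \<open>simp add: id_sig_eq_iter_int\<close>)
    then show "?K k = ?C k" ..
  qed simp
  finally show ?thesis
    by (simp add: n)
qed

theorem proposition4p11:
  fixes T :: real and X :: "real \<times> real \<Rightarrow> real ^ 'd"
    and n :: nat and w :: "'d list" and s1 s2 t1 t2 :: real
  assumes "T > 0"
    and "C2_on ({0..T} \<times> {0..T}) X"
    and "n \<ge> 1" and "length w = n"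
    and "(s1, s2) \<in> {0..T} \<times> {0..T}" and "(t1, t2) \<in> {0..T} \<times> {0..T}"
    and "s1 \<le> t1" and "s2 \<le> t2"
  shows "(\<forall>u1\<in>{s1..t1}.
            delta1 u1 (id_sig T X) (s1, s2) (t1, t2) w =
              (\<Sum>k = 1..n - 1.
                 conv1 T X (u1, s2) (t1, t2) (drop k w)
                   (\<lambda>y. id_sig T X (s1, s2) (u1, y) (take k w)))) \<and>
         (\<forall>u2\<in>{s2..t2}.
            delta2 u2 (id_sig T X) (s1, s2) (t1, t2) w =
              (\<Sum>k = 1..n - 1.
                 conv2 T X (s1, u2) (t1, t2) (drop k w)
                   (\<lambda>x. id_sig T X (s1, s2) (x, u2) (take k w))))"
proof (intro conjI ballI)
  have w: "w \<noteq> []"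
    using assms(3,4) by auto
  note delta = delta_id_sig[OF assms(1,2) w assms(5,6)]
  \<comment> \<open>Cutting the first coordinate leaves a function of \<open>snd (r 0)\<close>, as
    in \<open>conv1\<close>; cutting the second leaves one of \<open>fst (r 0)\<close>, as in
    \<open>conv2\<close>.\<close>
  have cut1: "cut (1, 0) u r = (u, snd r)" and cut2: "cut (0, 1) u r = (fst r, u)"
    for u :: real and r :: "real \<times> real"
    by (cases r; simp add: cut_def)+
  show "delta1 u1 (id_sig T X) (s1, s2) (t1, t2) w =
      (\<Sum>k = 1..n - 1. conv1 T X (u1, s2) (t1, t2) (drop k w)
         (\<lambda>y. id_sig T X (s1, s2) (u1, y) (take k w)))" if "u1 \<in> {s1..t1}" for u1
    using delta[of "(1, 0)" u1] that assms
    by (auto simp: cut1 delta1_def conv1_def Basis_prod_def)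
  show "delta2 u2 (id_sig T X) (s1, s2) (t1, t2) w =
      (\<Sum>k = 1..n - 1. conv2 T X (s1, u2) (t1, t2) (drop k w)
         (\<lambda>x. id_sig T X (s1, s2) (x, u2) (take k w)))" if "u2 \<in> {s2..t2}" for u2
    using delta[of "(0, 1)" u2] that assms
    by (auto simp: cut2 delta2_def conv2_def Basis_prod_def)
qed

end
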